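(* Let $F:(-1,1)\to\mathbb{C}$ be continuous and positive definite with $F(0)=1$, and let $\mu$ be a finite positive Borel measure on $\mathbb{R}$. Then the following two conditions are equivalent: (1) $\mu\in Ext(F)$; (2) for all $x\in(-1,1)$, $$\sum_{n\in\mathbb{Z}}\int_{\mathbb{R}}e^{i\lambda x}\,Sha\big(\pi(\lambda-n)\big)\,d\mu(\lambda)=F(x).$$
   Context: $F:(-1,1)\to\mathbb{C}$ is positive definite if $\sum_{i,j}\overline{c_i}c_jF(x_i-x_j)\ge0$ for all finite systems $c_i\in\mathbb{C}$, $x_i\in(0,1)$. $Ext(F)$ is the set of finite positive Borel measures $\mu$ on $\mathbb{R}$ such that $\int_{\mathbb{R}}e^{i\lambda x}\,d\mu(\lambda)=F(x)$ for all $x\in(-1,1)$. The Shannon kernel is $Sha(\xi)=e^{i\xi/2}\,\frac{\sin\xi}{\xi}$ for $\xi\in\mathbb{R}\setminus\{0\}$, $Sha(0)=1$. The series over $n\in\mathbb{Z}$ is understood as the limit of the symmetric partial sums $\sum_{|n|\le N}$ as $N\to\infty$. *)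

theory Defs
  imports "HOL-Probability.Probability"
begin

text \<open>A function on the interval \<open>(-1,1)\<close> is represented by a total function on the reals;
  the values outside that interval are irrelevant in all that follows.\<close>

definition positive_definite :: "(real \<Rightarrow> complex) \<Rightarrow> bool" where
  "positive_definite F \<longleftrightarrow>
     (\<forall>(m::nat) (c :: nat \<Rightarrow> complex) (x :: nat \<Rightarrow> real).
        (\<forall>i<m. x i \<in> {0<..<1}) \<longrightarrow>
        (\<Sum>i<m. \<Sum>j<m. cnj (c i) * c j * F (x i - x j)) \<in> \<real>\<^sub>\<ge>\<^sub>0)"

definition Ext :: "(real \<Rightarrow> complex) \<Rightarrow> real measure set" where
  "Ext F = {\<mu>. finite_borel_measure \<mu> \<and>
              (\<forall>x\<in>{-1<..<1}. (LINT l|\<mu>. exp (\<i> * of_real l * of_real x)) = F x)}"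

definition Sha :: "real \<Rightarrow> complex" where
  "Sha \<xi> = (if \<xi> = 0 then 1 else exp (\<i> * of_real \<xi> / 2) * of_real (sin \<xi> / \<xi>))"

end

theory Submission
  imports Defs "HOL-Complex_Analysis.Complex_Singularities"
begin

text \<open>
  The series converges to \<open>\<integral> e\<^sup>i\<^sup>l\<^sup>x d\<mu>(l)\<close> for every finite Borel measure \<open>\<mu>\<close> and every real \<open>x\<close>, so
  either side of the equivalence says that this integral is \<open>F x\<close> on \<open>(-1,1)\<close>. The convergence is a
  statement about the translates of the Shannon kernel alone: their symmetric partial sums
  \<open>S\<^sub>N(l) = \<Sum>\<bar>n\<bar>\<le>N. Sha (\<pi>(l - n))\<close> tend to \<open>1\<close> for each \<open>l\<close> and are bounded uniformly in
  \<open>N\<close> and \<open>l\<close>; dominated convergence does the rest.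

  For the limit, \<open>2 Sha (\<pi>y)\<close> is the integral of \<open>exp (i\<pi>yt)\<close> over \<open>t \<in> [-1/2, 3/2]\<close>, an interval
  of length \<open>2\<close>. Thus \<open>2 S\<^sub>N(l)\<close> is the integral of \<open>exp (i\<pi>lt)\<close> against the Dirichlet kernel of
  period \<open>2\<close>, that is, twice a partial sum at \<open>t = 0\<close> of the Fourier series of this
  exponential on the interval; as \<open>0\<close> is an interior point, the value \<open>1\<close> is to be expected.
  Since \<open>S\<^sub>N(0) = 1\<close>, the error
  \<open>2 (S\<^sub>N(l) - 1)\<close> is the integral of \<open>exp (i\<pi>lt) - 1\<close> against the Dirichlet kernel. The
  denominator \<open>exp (i\<pi>t) - 1\<close> of the kernel vanishes on the interval only at \<open>t = 0\<close>, where
  \<open>exp (i\<pi>lt) - 1\<close> vanishes too, so the error is an oscillatory integral with a smooth amplitude (\<open>exp_quotient_extends\<close>) and decays like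
  \<open>1/N\<close> (\<open>oscillatory_integral_bound\<close>).

  The constant in this decay depends on \<open>l\<close>, so the uniform bound (\<open>norm_Sha_sum_le\<close>) needs another
  argument. Away from the pole, \<open>Sha (\<pi>(l - n))\<close> is a factor bounded by \<open>1\<close> and independent of
  \<open>n\<close>, times \<open>\<i>\<^sup>n / (l - n)\<close> up to normalisation. The powers of \<open>\<i>\<close> have bounded partial sums and
  \<open>1 / (l - n)\<close> is monotone on either side of \<open>l\<close>, so summation by parts bounds both tails.
\<close>

section \<open>Oscillatory integrals with a smooth amplitude\<close>

text \<open>A quantitative Riemann-Lebesgue lemma: one integration by parts gains the factor
  \<open>1 / \<bar>\<omega>\<bar>\<close>, with a constant that depends on the amplitude only.\<close>

lemma oscillatory_integral_bound:
  fixes g g' :: "real \<Rightarrow> complex"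
  assumes ab: "a \<le> b"
    and deriv: "\<And>t. t \<in> {a..b} \<Longrightarrow> (g has_vector_derivative g' t) (at t within {a..b})"
    and cont: "continuous_on {a..b} g'"
  obtains C where "\<And>\<omega>. \<omega> \<noteq> 0 \<Longrightarrow>
    norm (integral {a..b} (\<lambda>t. g t * exp (\<i> * of_real (\<omega> * t)))) \<le> C / \<bar>\<omega>\<bar>"
proof -
  have "bounded (g' ` {a..b})"
    using cont by (intro compact_imp_bounded compact_continuous_image) auto
  then obtain B where B: "\<And>t. t \<in> {a..b} \<Longrightarrow> norm (g' t) \<le> B"
    unfolding bounded_iff by blast
  have "norm (integral {a..b} (\<lambda>t. g t * exp (\<i> * of_real (\<omega> * t))))
      \<le> (norm (g b) + norm (g a) + B * (b - a)) / \<bar>\<omega>\<bar>" if \<omega>: "\<omega> \<noteq> 0" for \<omega> :: real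
  proof -
    define e where "e = (\<lambda>t::real. exp (\<i> * of_real (\<omega> * t)))"
    have norm_e: "norm (e t) = 1" for t by (simp add: e_def)
    have e_deriv: "(e has_vector_derivative \<i> * of_real \<omega> * e t) (at t within {a..b})" for t
    proof -
      have "((\<lambda>z. exp (\<i> * of_real \<omega> * z)) has_field_derivative
          \<i> * of_real \<omega> * exp (\<i> * of_real \<omega> * of_real t)) (at (of_real t))"
        by (auto intro!: derivative_eq_intros)
      from has_vector_derivative_real_field[OF this] show ?thesis
        by (simp add: e_def mult.assoc)
    qed
    have cont_e: "continuous_on {a..b} e"
      unfolding e_def by (intro continuous_intros)
    have "((\<lambda>t. g' t * e t + g t * (\<i> * of_real \<omega> * e t)) has_integral (g b * e b - g a * e a)) {a..b}"
      using ab
    proof (rule fundamental_theorem_of_calculus)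
      show "((\<lambda>t. g t * e t) has_vector_derivative g' t * e t + g t * (\<i> * of_real \<omega> * e t)) (at t within {a..b})"
        if "t \<in> {a..b}" for t
        using has_vector_derivative_mult[OF deriv[OF that] e_deriv] by (simp add: add.commute)
    qed
    moreover have int: "((\<lambda>t. g' t * e t) has_integral integral {a..b} (\<lambda>t. g' t * e t)) {a..b}"
      using cont cont_e by (intro integrable_integral integrable_continuous_real continuous_intros)
    ultimately have "((\<lambda>t. (g' t * e t + g t * (\<i> * of_real \<omega> * e t)) - g' t * e t) has_integral
        (g b * e b - g a * e a - integral {a..b} (\<lambda>t. g' t * e t))) {a..b}"
      by (rule has_integral_diff)
    from has_integral_mult_right[OF this, of "1 / (\<i> * of_real \<omega>)"] \<omega>
    have "((\<lambda>t. g t * e t) has_integral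
        (g b * e b - g a * e a - integral {a..b} (\<lambda>t. g' t * e t)) / (\<i> * of_real \<omega>)) {a..b}"
      by (simp add: field_simps)
    then have "integral {a..b} (\<lambda>t. g t * e t) =
        (g b * e b - g a * e a - integral {a..b} (\<lambda>t. g' t * e t)) / (\<i> * of_real \<omega>)"
      by (rule integral_unique)
    also have "norm \<dots> = norm (g b * e b - g a * e a - integral {a..b} (\<lambda>t. g' t * e t)) / \<bar>\<omega>\<bar>"
      by (simp add: norm_divide norm_mult)
    also have "norm (g b * e b - g a * e a - integral {a..b} (\<lambda>t. g' t * e t))
        \<le> norm (g b * e b) + norm (g a * e a) + norm (integral {a..b} (\<lambda>t. g' t * e t))"
      by norm
    also have "norm (integral {a..b} (\<lambda>t. g' t * e t)) \<le> B * (b - a)"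
      using ab cont cont_e
      by (intro integral_bound) (auto intro!: continuous_intros simp: norm_mult norm_e B)
    finally have "norm (integral {a..b} (\<lambda>t. g t * e t)) \<le>
        (norm (g b) + norm (g a) + B * (b - a)) / \<bar>\<omega>\<bar>"
      by (simp add: norm_mult norm_e divide_right_mono)
    then show ?thesis by (simp only: e_def)
  qed
  then show thesis by (rule that)
qed

text \<open>The interval \<open>[-1/2, 3/2]\<close> contains \<open>0\<close> but no other zero of \<open>exp (i\<pi>t) - 1\<close>. At \<open>0\<close>
  the numerator vanishes as well, so the quotient has a removable singularity and is
  holomorphic on a strip around the interval, in particular continuously differentiable on it.\<close>

lemma exp_quotient_extends:
  fixes l :: real
  obtains g g' :: "real \<Rightarrow> complex" where
    "\<And>t. t \<in> {-1/2..3/2} \<Longrightarrow> (g has_vector_derivative g' t) (at t within {-1/2..3/2})"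
    "continuous_on {-1/2..3/2} g'"
    "\<And>t. t \<in> {-1/2..3/2} \<Longrightarrow>
       exp (\<i> * of_real (pi * l * t)) - 1 = g t * (exp (\<i> * of_real (pi * t)) - 1)"
proof -
  define A where "A = {z. -1 < Re z \<and> Re z < 2}"
  have "open A"
    unfolding A_def by (intro open_Collect_conj open_halfspace_Re_gt open_halfspace_Re_lt)
  define q where "q = (\<lambda>z. (exp (\<i> * pi * l * z) - 1) / (exp (\<i> * pi * z) - 1))"
  define G where "G = (\<lambda>z. if z = 0 then of_real l else q z)"
  have nz: "exp (\<i> * pi * z) \<noteq> 1" if "z \<in> A" "z \<noteq> 0" for z
  proof
    assume "exp (\<i> * pi * z) = 1"
    then obtain n :: int where n: "pi * Im z = 0" "pi * Re z = of_int (2 * n) * pi"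
      by (auto simp: exp_eq_1)
    then have "Im z = 0" "Re z = 2 * of_int n" by auto
    with that have "n = 0" unfolding A_def by auto
    with \<open>Im z = 0\<close> \<open>Re z = 2 * of_int n\<close> \<open>z \<noteq> 0\<close> show False
      by (simp add: complex_eq_iff)
  qed
  have "q holomorphic_on A - {0}"
    unfolding q_def using nz by (intro holomorphic_intros) auto
  \<comment> \<open>by l'Hopital, the quotient tends to \<open>i\<pi>l / (i\<pi>) = l\<close>\<close>
  moreover have "q \<midarrow>0\<rightarrow> of_real l"
    unfolding q_def
    by (rule lhopital_complex_simple[where f' = "\<i> * pi * l" and g' = "\<i> * pi"])
      (auto intro!: derivative_eq_intros)
  ultimately have holo: "G holomorphic_on A"
    unfolding G_def using \<open>open A\<close> by (intro removable_singularity)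
  have in_A: "of_real t \<in> A" if "t \<in> {-1/2..3/2}" for t :: real
    using that by (auto simp: A_def)
  show thesis
  proof (rule that[of "\<lambda>t. G (of_real t)" "\<lambda>t. deriv G (of_real t)"])
    show "((\<lambda>t. G (of_real t)) has_vector_derivative deriv G (of_real t)) (at t within {-1/2..3/2})"
      if "t \<in> {-1/2..3/2}" for t
      using holomorphic_derivI[OF holo \<open>open A\<close> in_A[OF that]]
      by (rule has_vector_derivative_real_field)
    have "continuous_on A (deriv G)"
      using holo \<open>open A\<close> by (intro holomorphic_on_imp_continuous_on holomorphic_deriv)
    then show "continuous_on {-1/2..3/2} (\<lambda>t::real. deriv G (of_real t))"
      by (rule continuous_on_compose2) (auto intro!: continuous_intros in_A)
    show "exp (\<i> * of_real (pi * l * t)) - 1 = G (of_real t) * (exp (\<i> * of_real (pi * t)) - 1)"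
      if "t \<in> {-1/2..3/2}" for t
      using nz[OF in_A[OF that]] by (auto simp: G_def q_def mult.assoc)
  qed
qed

section \<open>The translates of the Shannon kernel sum to one\<close>

text \<open>The factor \<open>exp (i\<pi>y/2)\<close> in the kernel is what shifts the symmetric interval
  \<open>[-1, 1]\<close>, whose transform is the plain cardinal sine, to \<open>[-1/2, 3/2]\<close>.\<close>

lemma has_integral_Sha:
  "((\<lambda>t. exp (\<i> * of_real (pi * y * t))) has_integral 2 * Sha (pi * y)) {-1/2..3/2}"
proof (cases "y = 0")
  case True
  then show ?thesis
    using has_integral_const_real[of "1::complex" "-1/2" "3/2"]
    by (simp add: Sha_def scaleR_conv_of_real)
next
  case False
  define E where "E = (\<lambda>t::real. exp (\<i> * of_real (pi * y * t)) / (\<i> * of_real (pi * y)))"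
  have "((\<lambda>t. exp (\<i> * of_real (pi * y * t))) has_integral E (3/2) - E (-1/2)) {-1/2..3/2}"
  proof (rule fundamental_theorem_of_calculus)
    show "(E has_vector_derivative exp (\<i> * of_real (pi * y * t))) (at t within {-1/2..3/2})" for t
    proof -
      have "((\<lambda>z. exp (\<i> * of_real (pi * y) * z) / (\<i> * of_real (pi * y))) has_field_derivative
          exp (\<i> * of_real (pi * y) * of_real t)) (at (of_real t))"
        using False by (auto intro!: derivative_eq_intros)
      from has_vector_derivative_real_field[OF this] show ?thesis
        by (simp add: E_def mult.assoc)
    qed
  qed simp
  also have "E (3/2) - E (-1/2) = 2 * Sha (pi * y)"
  proof -
    define p where "p = exp (\<i> * of_real (pi * y) / 2)"
    define q r where "q = exp (\<i> * of_real (pi * y))" and "r = exp (- (\<i> * of_real (pi * y)))"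
    have ends: "exp (\<i> * of_real (pi * y * (3/2))) = p * q" "exp (\<i> * of_real (pi * y * (-1/2))) = p * r"
      unfolding p_def q_def r_def by (simp_all add: field_simps flip: exp_add)
    have "E (3/2) - E (-1/2) = p * (q - r) / (\<i> * of_real (pi * y))"
      unfolding E_def ends by (simp add: diff_divide_distrib right_diff_distrib)
    also have "q - r = 2 * \<i> * of_real (sin (pi * y))"
      unfolding q_def r_def sin_of_real[symmetric] sin_exp_eq by simp
    also have "p * (2 * \<i> * of_real (sin (pi * y))) / (\<i> * of_real (pi * y)) = 2 * Sha (pi * y)"
      using False by (simp add: Sha_def p_def)
    finally show ?thesis .
  qed
  finally show ?thesis .
qed

lemma sum_symmetric_Suc:
  fixes f :: "int \<Rightarrow> 'a::comm_monoid_add"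
  shows "(\<Sum>n\<in>{- int (Suc N)..int (Suc N)}. f n) =
    f (int N + 1) + f (- int N - 1) + (\<Sum>n\<in>{- int N..int N}. f n)"
proof -
  have "{- int (Suc N)..int (Suc N)} = insert (int N + 1) (insert (- int N - 1) {- int N..int N})"
    by auto
  then show ?thesis by (simp add: add_ac)
qed

lemma dirichlet_kernel_telescopes:
  fixes z :: complex
  shows "(exp z - 1) * (\<Sum>n\<in>{- int N..int N}. exp (- (of_int n * z))) =
    exp ((of_nat N + 1) * z) - exp (- (of_nat N * z))"
proof (induction N)
  case 0
  then show ?case by simp
next
  case (Suc N)
  show ?case
    by (simp only: sum_symmetric_Suc distrib_left Suc) (simp add: algebra_simps flip: exp_add)
qed

text \<open>The Dirichlet kernel, multiplied by \<open>exp (i\<pi>t) - 1\<close>, leaves two pure oscillations of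
  frequencies \<open>\<pi>(N + 1)\<close> and \<open>-\<pi>N\<close>. Subtracting the case \<open>l = 0\<close>, where the sum is exactly \<open>1\<close>,
  supplies this factor at the cost of the smooth amplitude of \<open>exp_quotient_extends\<close>.\<close>

lemma Sha_sum_tendsto_1:
  "(\<lambda>N. \<Sum>n\<in>{- int N..int N}. Sha (pi * (l - of_int n))) \<longlonglongrightarrow> 1"
proof -
  define S where "S = (\<lambda>N l. \<Sum>n\<in>{- int N..int N}. Sha (pi * (l - of_int n)))"
  let ?I = "{-1/2..3/2::real}"
  obtain g g' :: "real \<Rightarrow> complex" where
    g_deriv: "\<And>t. t \<in> ?I \<Longrightarrow> (g has_vector_derivative g' t) (at t within ?I)"
    and g_cont: "continuous_on ?I g'"
    and g: "\<And>t. t \<in> ?I \<Longrightarrow>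
       exp (\<i> * of_real (pi * l * t)) - 1 = g t * (exp (\<i> * of_real (pi * t)) - 1)"
    by (rule exp_quotient_extends[of l]) blast
  obtain C where C: "\<And>\<omega>. \<omega> \<noteq> 0 \<Longrightarrow>
      norm (integral ?I (\<lambda>t. g t * exp (\<i> * of_real (\<omega> * t)))) \<le> C / \<bar>\<omega>\<bar>"
    using oscillatory_integral_bound[OF _ g_deriv g_cont] by auto
  have "continuous_on ?I g"
    unfolding continuous_on_eq_continuous_within
    using g_deriv has_vector_derivative_continuous by blast
  then have g_integrable: "(\<lambda>t. g t * exp (\<i> * of_real (\<omega> * t))) integrable_on ?I" for \<omega>
    by (intro integrable_continuous_real continuous_intros)
  have S0: "S N 0 = 1" for N
  proof -
    have "S N 0 = (\<Sum>n\<in>{- int N..int N}. if n = 0 then 1 else 0)"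
      unfolding S_def by (intro sum.cong) (auto simp: Sha_def sin_times_pi_eq_0 mult.commute)
    then show ?thesis by simp
  qed
  have S_int: "((\<lambda>t. exp (\<i> * of_real (pi * \<mu> * t)) *
      (\<Sum>n\<in>{- int N..int N}. exp (- (of_int n * (\<i> * of_real (pi * t)))))) has_integral 2 * S N \<mu>) ?I" for N \<mu>
  proof -
    have "((\<lambda>t. \<Sum>n\<in>{- int N..int N}. exp (\<i> * of_real (pi * (\<mu> - of_int n) * t)))
        has_integral (\<Sum>n\<in>{- int N..int N}. 2 * Sha (pi * (\<mu> - of_int n)))) ?I"
      by (intro has_integral_sum has_integral_Sha) auto
    moreover have "(\<Sum>n\<in>{- int N..int N}. exp (\<i> * of_real (pi * (\<mu> - of_int n) * t))) =
      exp (\<i> * of_real (pi * \<mu> * t)) * (\<Sum>n\<in>{- int N..int N}. exp (- (of_int n * (\<i> * of_real (pi * t)))))" for t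
      unfolding sum_distrib_left by (intro sum.cong) (simp_all add: algebra_simps flip: exp_add)
    ultimately show ?thesis by (simp add: S_def sum_distrib_left)
  qed
  have "C \<ge> 0"
    using order.trans[OF norm_ge_zero C[of 1]] by simp
  have rate: "norm (S N l - 1) \<le> C / (pi * real N)" if "N > 0" for N
  proof -
    have "((\<lambda>t. (exp (\<i> * of_real (pi * l * t)) - 1) *
        (\<Sum>n\<in>{- int N..int N}. exp (- (of_int n * (\<i> * of_real (pi * t)))))) has_integral 2 * (S N l - 1)) ?I"
      using has_integral_diff[OF S_int[of l N] S_int[of 0 N]] by (simp add: S0 algebra_simps)
    moreover have "(exp (\<i> * of_real (pi * l * t)) - 1) *
        (\<Sum>n\<in>{- int N..int N}. exp (- (of_int n * (\<i> * of_real (pi * t))))) =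
        g t * exp (\<i> * of_real (pi * (real N + 1) * t)) - g t * exp (\<i> * of_real (- pi * real N * t))"
      if "t \<in> ?I" for t
      unfolding g[OF that] mult.assoc[of "g t"] dirichlet_kernel_telescopes
      by (simp add: algebra_simps)
    ultimately have "((\<lambda>t. g t * exp (\<i> * of_real (pi * (real N + 1) * t)) -
        g t * exp (\<i> * of_real (- pi * real N * t))) has_integral 2 * (S N l - 1)) ?I"
      by (rule has_integral_eq[rotated])
    from integral_unique[OF this, symmetric]
    have "2 * (S N l - 1) = integral ?I (\<lambda>t. g t * exp (\<i> * of_real (pi * (real N + 1) * t))) -
        integral ?I (\<lambda>t. g t * exp (\<i> * of_real (- pi * real N * t)))"
      by (simp only: integral_diff[OF g_integrable g_integrable])
    then have "norm (2 * (S N l - 1)) \<le>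
        norm (integral ?I (\<lambda>t. g t * exp (\<i> * of_real (pi * (real N + 1) * t)))) +
        norm (integral ?I (\<lambda>t. g t * exp (\<i> * of_real (- pi * real N * t))))"
      by (simp only: norm_triangle_ineq4)
    also have "\<dots> \<le> C / \<bar>pi * (real N + 1)\<bar> + C / \<bar>- pi * real N\<bar>"
    proof (rule add_mono; rule C)
      show "pi * (real N + 1) \<noteq> 0" by (simp add: add_nonneg_eq_0_iff)
      show "- pi * real N \<noteq> 0" using that by simp
    qed
    also have "\<bar>- pi * real N\<bar> = pi * real N"
      by (simp add: abs_mult)
    also have "C / \<bar>pi * (real N + 1)\<bar> \<le> C / (pi * real N)"
      using that \<open>C \<ge> 0\<close> by (intro divide_left_mono) auto
    finally show ?thesis
      by (simp only: norm_mult norm_numeral) linarith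
  qed
  have "(\<lambda>N. S N l - 1) \<longlonglongrightarrow> 0"
  proof (rule Lim_null_comparison)
    show "\<forall>\<^sub>F N in sequentially. norm (S N l - 1) \<le> C / (pi * real N)"
      using eventually_gt_at_top[of 0] by eventually_elim (rule rate)
    show "(\<lambda>N. C / (pi * real N)) \<longlonglongrightarrow> 0"
      by real_asymp
  qed
  then show ?thesis
    by (simp add: S_def LIM_zero_iff)
qed

section \<open>A uniform bound for the partial sums\<close>

lemma norm_Sha_le_1: "norm (Sha \<xi>) \<le> 1"
proof -
  have "\<bar>sin \<xi>\<bar> \<le> \<bar>\<xi>\<bar>" by (rule abs_sin_x_le_abs_x)
  then have "\<bar>sin \<xi> / \<xi>\<bar> \<le> 1" if "\<xi> \<noteq> 0" using that by (simp add: abs_divide)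
  moreover have "norm (exp (\<i> * of_real \<xi> / 2)) = 1" by (simp add: norm_exp_eq_Re)
  ultimately show ?thesis by (auto simp: Sha_def norm_mult simp del: norm_exp_eq_Re norm_divide of_real_divide)
qed

text \<open>Summation by parts moves the differences from \<open>u\<close> to \<open>f\<close>, and the increments of the
  monotone \<open>f\<close> telescope. The induction carries the boundary term at the upper end along.
  Since \<open>f\<close> may have either sign, the lemma serves both sides of the pole of
  \<open>1 / (l - n)\<close>, which increases in \<open>n\<close> on each of them.\<close>

lemma abel_sum_bound:
  fixes f :: "int \<Rightarrow> real" and u :: "int \<Rightarrow> complex"
  assumes u: "\<And>n. norm (u n) \<le> 1"
    and mono: "\<And>m n. a \<le> m \<Longrightarrow> m \<le> n \<Longrightarrow> n \<le> b \<Longrightarrow> f m \<le> f n"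
    and bound: "\<And>n. a \<le> n \<Longrightarrow> n \<le> b \<Longrightarrow> \<bar>f n\<bar> \<le> 1"
  shows "norm (\<Sum>n\<in>{a..b}. of_real (f n) * (u (n + 1) - u n)) \<le> 4"
proof (cases "a \<le> b")
  case True
  have "k \<le> b \<Longrightarrow> norm ((\<Sum>n\<in>{a..k}. of_real (f n) * (u (n + 1) - u n)) - of_real (f k) * u (k + 1))
      \<le> \<bar>f a\<bar> + (f k - f a)" if "a \<le> k" for k
    using that
  proof (induction k rule: int_ge_induct)
    case base
    show ?case
      using mult_left_mono[OF u[of a], of "\<bar>f a\<bar>"] by (simp add: algebra_simps norm_mult)
  next
    case (step k)
    let ?D = "\<lambda>k. (\<Sum>n\<in>{a..k}. of_real (f n) * (u (n + 1) - u n)) - of_real (f k) * u (k + 1)"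
    have "{a..k+1} = insert (k+1) {a..k}" using step by auto
    then have "?D (k + 1) = ?D k - of_real (f (k + 1) - f k) * u (k + 1)"
      by (simp add: algebra_simps)
    also have "norm \<dots> \<le> norm (?D k) + norm (of_real (f (k + 1) - f k) * u (k + 1))"
      by (rule norm_triangle_ineq4)
    also have "norm (of_real (f (k + 1) - f k) * u (k + 1)) \<le> f (k + 1) - f k"
      using mult_left_mono[OF u[of "k+1"], of "f (k + 1) - f k"] mono[of k "k+1"] step
      by (simp add: norm_mult del: of_real_diff)
    also have "norm (?D k) \<le> \<bar>f a\<bar> + (f k - f a)" using step by simp
    finally show ?case by simp
  qed
  from this[OF True order.refl]
  have "norm (\<Sum>n\<in>{a..b}. of_real (f n) * (u (n + 1) - u n))
      \<le> \<bar>f a\<bar> + (f b - f a) + norm (of_real (f b) * u (b + 1))"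
    by norm
  also have "norm (of_real (f b) * u (b + 1)) \<le> \<bar>f b\<bar>"
    using mult_left_mono[OF u[of "b+1"], of "\<bar>f b\<bar>"] by (simp add: norm_mult)
  finally show ?thesis
    using bound[of a] bound[of b] True by linarith
qed simp

text \<open>The dependence on \<open>n\<close> is isolated in \<open>\<i>\<^sup>n / (l - n)\<close>: the sign \<open>(-1)\<^sup>n\<close> from the sine and
  the phase \<open>exp (-i\<pi>n/2) = (-\<i>)\<^sup>n\<close> combine to \<open>\<i>\<^sup>n\<close>. Writing \<open>\<i>\<^sup>n\<close> as a difference of consecutive
  powers, at the cost of the division by \<open>\<i> - 1\<close>, prepares it for \<open>abel_sum_bound\<close>.\<close>

lemma Sha_shift:
  assumes "l \<noteq> of_int n"
  shows "Sha (pi * (l - of_int n)) =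
    exp (\<i> * of_real (pi * l) / 2) * of_real (sin (pi * l) / pi) / (\<i> - 1) *
    (of_real (1 / (l - of_int n)) * (\<i> powi (n + 1) - \<i> powi n))"
proof -
  define e where "e = exp (\<i> * of_real (pi * (l - of_int n)) / 2)"
  define c where "c = cos (pi * of_int n)"
  define d where "d = l - of_int n"
  have ec: "e * of_real c = exp (\<i> * of_real (pi * l) / 2) * \<i> powi n"
  proof -
    have "\<i> powi n = cis (of_int n * (pi / 2))"
      by (subst cis_power_int[symmetric]) simp
    moreover have "of_real c = cis (pi * of_int n)"
      by (simp add: complex_eq_iff c_def)
    moreover have "exp (\<i> * of_real t / 2) = cis (t / 2)" for t :: real
      by (simp add: cis_conv_exp)
    ultimately show ?thesis
      unfolding e_def by (simp only: cis_mult) (simp add: algebra_simps diff_divide_distrib)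
  qed
  have "Sha (pi * d) = e * of_real (sin (pi * d) / (pi * d))"
    using assms by (simp add: Sha_def e_def d_def)
  also have "sin (pi * d) = sin (pi * l) * c"
    by (simp add: d_def c_def right_diff_distrib sin_diff)
  also have "e * of_real (sin (pi * l) * c / (pi * d)) =
      e * of_real c * of_real (sin (pi * l) / pi) * of_real (1 / d)"
    by simp
  also have "\<dots> = exp (\<i> * of_real (pi * l) / 2) * of_real (sin (pi * l) / pi) *
      (of_real (1 / d) * \<i> powi n)"
    unfolding ec by (simp only: ac_simps)
  also have "\<i> powi n = (\<i> powi (n + 1) - \<i> powi n) / (\<i> - 1)"
  proof -
    have "\<i> - 1 \<noteq> 0" by (simp add: complex_eq_iff)
    moreover have "\<i> powi (n + 1) - \<i> powi n = (\<i> - 1) * \<i> powi n"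
      by (simp add: power_int_add algebra_simps)
    ultimately show ?thesis by simp
  qed
  finally show ?thesis
    unfolding d_def by (simp only: times_divide_eq_left times_divide_eq_right)
qed

text \<open>At most two integers \<open>n\<close> lie at distance less than \<open>1\<close> from \<open>l\<close>, and their terms are
  bounded by \<open>1\<close> each. On either side of them summation by parts applies with
  \<open>\<bar>1 / (l - n)\<bar> \<le> 1\<close>, which gives \<open>4 + 2 + 4\<close>.\<close>

lemma norm_Sha_sum_le: "norm (\<Sum>n\<in>{- int N..int N}. Sha (pi * (l - of_int n))) \<le> 10"
proof -
  define m where "m = \<lfloor>l\<rfloor>"
  have m: "of_int m \<le> l" "l < of_int m + 1" unfolding m_def by linarith+
  have below: "of_int n \<le> l - 1" if "n \<le> m - 1" for n using m that by linarith
  have above: "l + 1 \<le> of_int n" if "m + 2 \<le> n" for n using m that by linarith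
  let ?S = "\<lambda>n. Sha (pi * (l - of_int n))"
  define K where "K = exp (\<i> * of_real (pi * l) / 2) * of_real (sin (pi * l) / pi) / (\<i> - 1)"
  have "norm (exp (\<i> * of_real (pi * l) / 2)) = 1" by (simp add: norm_exp_eq_Re)
  moreover have "\<bar>sin (pi * l) / pi\<bar> \<le> 1"
    using abs_sin_le_one[of "pi * l"] pi_gt3 by (simp add: abs_divide del: abs_sin_le_one)
  moreover have "norm (\<i> - 1) \<ge> 1"
    using abs_Re_le_cmod[of "\<i> - 1"] by simp
  ultimately have "norm K \<le> 1 / 1"
    unfolding K_def norm_mult norm_divide norm_of_real by (intro frac_le) auto
  then have K: "norm K \<le> 1" by simp
  have far: "norm (\<Sum>n\<in>{a..b}. ?S n) \<le> 4"
    if side: "(\<forall>n\<in>{a..b}. of_int n \<le> l - 1) \<or> (\<forall>n\<in>{a..b}. l + 1 \<le> of_int n)" for a b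
  proof -
    have apart: "of_int n \<le> l - 1 \<or> l + 1 \<le> of_int n" if "n \<in> {a..b}" for n
      using side that by blast
    have "l \<noteq> of_int n" if "n \<in> {a..b}" for n
      using apart[OF that] by linarith
    then have "(\<Sum>n\<in>{a..b}. ?S n) =
        K * (\<Sum>n\<in>{a..b}. of_real (1 / (l - of_int n)) * (\<i> powi (n + 1) - \<i> powi n))"
      unfolding sum_distrib_left K_def by (intro sum.cong refl Sha_shift)
    also have "norm \<dots> \<le> 1 * 4"
      unfolding norm_mult
    proof (intro mult_mono K abel_sum_bound)
      show "norm (\<i> powi n) \<le> 1" for n by (simp add: norm_power_int)
      show "1 / (l - of_int p) \<le> 1 / (l - of_int n)" if "a \<le> p" "p \<le> n" "n \<le> b" for p n
      proof -
        have "p \<in> {a..b}" "n \<in> {a..b}" using that by auto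
        then have "(l - of_int p) * (l - of_int n) > 0"
          using side by (force simp: zero_less_mult_iff)
        then show ?thesis using \<open>p \<le> n\<close>
          by (intro divide_left_mono) auto
      qed
      show "\<bar>1 / (l - of_int n)\<bar> \<le> 1" if "a \<le> n" "n \<le> b" for n
        using apart[of n] that by (auto simp: abs_divide)
    qed auto
    finally show ?thesis by simp
  qed
  have split: "{- int N..int N} = {- int N..min (int N) (m - 1)} \<union>
      ({- int N..int N} \<inter> {m, m + 1}) \<union> {max (- int N) (m + 2)..int N}"
    by auto
  have "norm (\<Sum>n\<in>{- int N..int N}. ?S n) \<le>
      norm (\<Sum>n\<in>{- int N..min (int N) (m - 1)}. ?S n) +
      norm (\<Sum>n\<in>{- int N..int N} \<inter> {m, m + 1}. ?S n) +
      norm (\<Sum>n\<in>{max (- int N) (m + 2)..int N}. ?S n)"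
    by (subst split, subst sum.union_disjoint, simp, simp, force,
        subst sum.union_disjoint, simp, simp, force) (intro norm_triangle_le add_mono order.refl norm_triangle_ineq)
  also have "\<dots> \<le> 4 + 2 + 4"
  proof (intro add_mono far)
    show "(\<forall>n\<in>{- int N..min (int N) (m - 1)}. of_int n \<le> l - 1) \<or>
        (\<forall>n\<in>{- int N..min (int N) (m - 1)}. l + 1 \<le> of_int n)"
      by (intro disjI1 ballI below) simp
    show "(\<forall>n\<in>{max (- int N) (m + 2)..int N}. of_int n \<le> l - 1) \<or>
        (\<forall>n\<in>{max (- int N) (m + 2)..int N}. l + 1 \<le> of_int n)"
      by (intro disjI2 ballI above) simp
    have "norm (\<Sum>n\<in>{- int N..int N} \<inter> {m, m + 1}. ?S n) \<le> real (card ({- int N..int N} \<inter> {m, m + 1})) * 1"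
      by (intro sum_norm_bound norm_Sha_le_1)
    also have "card ({- int N..int N} \<inter> {m, m + 1}) \<le> card {m, m + 1}"
      by (intro card_mono) auto
    finally show "norm (\<Sum>n\<in>{- int N..int N} \<inter> {m, m + 1}. ?S n) \<le> 2" by simp
  qed
  finally show ?thesis by simp
qed

section \<open>Integration against a finite measure\<close>

lemma borel_measurable_Sha [measurable]: "Sha \<in> borel_measurable borel"
  unfolding Sha_def[abs_def] by measurable

theorem Sha_series_tendsto_integral:
  assumes "finite_borel_measure \<mu>"
  shows "(\<lambda>N. \<Sum>n\<in>{- int N..int N}.
          (LINT l|\<mu>. exp (\<i> * of_real l * of_real x) * Sha (pi * (l - of_int n))))
        \<longlonglongrightarrow> (LINT l|\<mu>. exp (\<i> * of_real l * of_real x))"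
proof -
  interpret finite_borel_measure \<mu> by fact
  have [measurable_cong]: "sets \<mu> = sets borel" by (rule M_is_borel)
  let ?e = "\<lambda>l::real. exp (\<i> * of_real l * of_real x)"
  let ?S = "\<lambda>N l. \<Sum>n\<in>{- int N..int N}. Sha (pi * (l - of_int n))"
  have norm_e: "norm (?e l) = 1" for l by (simp add: norm_exp_eq_Re)
  have "(\<lambda>N. LINT l|\<mu>. ?e l * ?S N l) \<longlonglongrightarrow> (LINT l|\<mu>. ?e l)"
  proof (rule integral_dominated_convergence[where w = "\<lambda>_. 10"])
    show "AE l in \<mu>. (\<lambda>N. ?e l * ?S N l) \<longlonglongrightarrow> ?e l"
      using tendsto_mult[OF tendsto_const Sha_sum_tendsto_1] by (intro AE_I2) fastforce
    show "AE l in \<mu>. norm (?e l * ?S N l) \<le> 10" for N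
      by (intro AE_I2) (simp add: norm_mult norm_e norm_Sha_sum_le)
  qed measurable
  moreover have "(LINT l|\<mu>. ?e l * ?S N l) =
      (\<Sum>n\<in>{- int N..int N}. LINT l|\<mu>. ?e l * Sha (pi * (l - of_int n)))" for N
  proof -
    have "integrable \<mu> (\<lambda>l. ?e l * Sha (pi * (l - of_int n)))" for n
      by (rule integrable_const_bound[where B = 1])
        (auto simp: norm_mult norm_e norm_Sha_le_1)
    then show ?thesis by (simp add: sum_distrib_left)
  qed
  ultimately show ?thesis by simp
qed

theorem corollary4p1p16:
  fixes F :: "real \<Rightarrow> complex" and \<mu> :: "real measure"
  assumes "continuous_on {-1<..<1} F"
    and "positive_definite F"
    and "F 0 = 1"
    and "finite_borel_measure \<mu>"
  shows "\<mu> \<in> Ext F \<longleftrightarrow>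
    (\<forall>x\<in>{-1<..<1}.
      (\<lambda>N::nat. \<Sum>n\<in>{- int N..int N}.
          (LINT l|\<mu>. exp (\<i> * of_real l * of_real x) * Sha (pi * (l - of_int n))))
        \<longlonglongrightarrow> F x)"
proof -
  have "(LINT l|\<mu>. exp (\<i> * of_real l * of_real x)) = F x \<longleftrightarrow>
      (\<lambda>N::nat. \<Sum>n\<in>{- int N..int N}.
        (LINT l|\<mu>. exp (\<i> * of_real l * of_real x) * Sha (pi * (l - of_int n)))) \<longlonglongrightarrow> F x" for x
    using Sha_series_tendsto_integral[OF assms(4), of x]
    by (auto dest: LIMSEQ_unique)
  then show ?thesis
    using assms(4) by (simp add: Ext_def)
qed

end
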